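(* Let $p(x,y)$ and $q(x,y)$ be linearly independent bivariate polynomials of degree two with complex coefficients. Suppose there exist four pairwise noncollinear vectors $(\alpha_i,\beta_i)\in\mathbb{C}^2$, $i=1,\dots,4$, such that each of the polynomials $r_i(x,y)=\alpha_ip(x,y)+\beta_iq(x,y)$ is factorizable. Then at least one of the following conditions holds: (a') $p$ and $q$ have a common factor of first degree: $p=\ell\,\ell_1$ and $q=\ell\,\ell_2$, where $\ell,\ell_1,\ell_2\in\Pi_1^2$; (b') $p(x,y)=f(s)$ and $q(x,y)=g(s)$, where $f$ and $g$ are univariate polynomials of degree two and $s=a_1x+b_1y$ with $a_1,b_1\in\mathbb{C}$, $a_1^2+b_1^2\neq0$; (c') $p(x,y)=f(s,t)$ and $q(x,y)=g(s,t)$, where $f,g\in\dot\Pi_2^2$ are bivariate homogeneous polynomials of degree two and $s=a_1x+b_1y+c_1$, $t=a_2x+b_2y+c_2$ for some $a_i,b_i,c_i\in\mathbb{C}$. Moreover, the polynomial $r(x,y)=\alpha p(x,y)+\beta q(x,y)$ is factorizable for all $\alpha,\beta\in\mathbb{C}$.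
   Context: All polynomials have complex coefficients. $\Pi_n^2=\{\sum_{i+j\le n}a_{ij}x^iy^j\}$ is the vector space of bivariate polynomials of total degree at most $n$, and $\dot\Pi_2^2$ is the vector space of homogeneous bivariate polynomials of degree $2$ (including the zero polynomial). A polynomial $r\in\Pi_2^2$ is factorizable if it equals $m_1m_2$ with $m_1,m_2\in\Pi_1^2$ (constant factors allowed, so that polynomials of degree at most one in $\Pi_2^2$ count as factorizable); equivalently, its associated homogeneous polynomial $\bar r(x,y,z)=\sum_{i+j+k=2}a_{ij}x^iy^jz^k$, where $r=\sum_{i+j\le2}a_{ij}x^iy^j$, is a product of two homogeneous linear polynomials in $x,y,z$. Two vectors in $\mathbb{C}^2$ are noncollinear if they are linearly independent over $\mathbb{C}$. *)

theory Defs
  imports "HOL-Computational_Algebra.Computational_Algebra" "HOL-Analysis.Analysis"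
begin

text \<open>
  A bivariate polynomial is a polynomial in \<open>x\<close> whose coefficients are polynomials in \<open>y\<close>:
  the coefficient \<open>a\<^sub>i\<^sub>j\<close> of \<open>x\<^sup>i y\<^sup>j\<close> in \<open>p\<close> is \<open>coeff (coeff p i) j\<close>.
\<close>
type_synonym bipoly = "complex poly poly"

definition bconst :: "complex \<Rightarrow> bipoly"
  where "bconst c = [:[:c:]:]"

definition var_x :: bipoly
  where "var_x = [:0, 1:]"

definition var_y :: bipoly
  where "var_y = [:[:0, 1:]:]"

definition bscale :: "complex \<Rightarrow> bipoly \<Rightarrow> bipoly"
  where "bscale c p = bconst c * p"

definition Pi2 :: "nat \<Rightarrow> bipoly set"
  where "Pi2 n = {p. \<forall>i j. i + j > n \<longrightarrow> coeff (coeff p i) j = 0}"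

definition Pi2_hom :: "nat \<Rightarrow> bipoly set"
  where "Pi2_hom n = {p. \<forall>i j. i + j \<noteq> n \<longrightarrow> coeff (coeff p i) j = 0}"

text \<open>The zero polynomial has total degree 0, following \<^const>\<open>degree\<close>.\<close>
definition total_degree :: "bipoly \<Rightarrow> nat"
  where "total_degree p = (LEAST n. p \<in> Pi2 n)"

definition factorizable :: "bipoly \<Rightarrow> bool"
  where "factorizable r \<longleftrightarrow> r \<in> Pi2 2 \<and> (\<exists>m1 \<in> Pi2 1. \<exists>m2 \<in> Pi2 1. r = m1 * m2)"

text \<open>
  \<open>usubst f s\<close> is \<open>f(s)\<close> for univariate \<open>f\<close>; \<open>bsubst f s t\<close> is \<open>f(s, t)\<close>, where \<open>s\<close> replaces
  the first (outer) and \<open>t\<close> the second (inner) variable of \<open>f\<close>.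
\<close>
definition usubst :: "complex poly \<Rightarrow> bipoly \<Rightarrow> bipoly"
  where "usubst f s = poly (map_poly bconst f) s"

definition bsubst :: "bipoly \<Rightarrow> bipoly \<Rightarrow> bipoly \<Rightarrow> bipoly"
  where "bsubst f s t = poly (map_poly (\<lambda>c. usubst c t) f) s"

text \<open>
  Linear independence of the family \<open>u, v\<close>. The library notion is about sets, so \<open>u = v\<close>,
  which would collapse the set to a singleton, is excluded separately.
\<close>
definition lin_indep2 :: "('k::field \<Rightarrow> 'v::ab_group_add \<Rightarrow> 'v) \<Rightarrow> 'v \<Rightarrow> 'v \<Rightarrow> bool"
  where "lin_indep2 scl u v \<longleftrightarrow> u \<noteq> v \<and> \<not> module.dependent scl {u, v}"

definition noncollinear :: "complex ^ 2 \<Rightarrow> complex ^ 2 \<Rightarrow> bool"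
  where "noncollinear u v \<longleftrightarrow> lin_indep2 (*s) u v"

lemma vector_space_bscale: "vector_space bscale"
proof -
  have "bconst (a + b) = bconst a + bconst b" "bconst (a * b) = bconst a * bconst b"
    "bconst 1 = 1" for a b
    by (simp_all add: bconst_def one_pCons)
  then show ?thesis
    by unfold_locales (simp_all add: bscale_def distrib_left distrib_right mult.assoc)
qed

lemma lin_indep2_iff:
  assumes "vector_space scl"
  shows "lin_indep2 scl u v \<longleftrightarrow>
    (\<forall>a b. scl a u + scl b v = 0 \<longrightarrow> a = 0 \<and> b = 0)"
proof -
  interpret vector_space scl by fact
  show ?thesis
  proof (cases "u = v")
    case True
    have "scl 1 u + scl (-1) u = 0" by simp
    then show ?thesis using True unfolding lin_indep2_def
      by (metis one_neq_zero)
  next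
    case False
    have "dependent {u, v} \<longleftrightarrow> (\<exists>w. (w u \<noteq> 0 \<or> w v \<noteq> 0) \<and> scl (w u) u + scl (w v) v = 0)"
      using False by (subst dependent_finite) auto
    also have "\<dots> \<longleftrightarrow> (\<exists>a b. (a \<noteq> 0 \<or> b \<noteq> 0) \<and> scl a u + scl b v = 0)"
    proof
      assume "\<exists>a b. (a \<noteq> 0 \<or> b \<noteq> 0) \<and> scl a u + scl b v = 0"
      then obtain a b where ab: "a \<noteq> 0 \<or> b \<noteq> 0" "scl a u + scl b v = 0" by blast
      show "\<exists>w. (w u \<noteq> 0 \<or> w v \<noteq> 0) \<and> scl (w u) u + scl (w v) v = 0"
        by (rule exI[of _ "\<lambda>z. if z = u then a else b"]) (use ab False in auto)
    qed blast
    finally show ?thesis using False unfolding lin_indep2_def by blast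
  qed
qed

lemma usubst_altdef: "usubst f s = (\<Sum>j\<le>degree f. bscale (coeff f j) (s ^ j))"
proof -
  have [simp]: "bconst 0 = 0" by (simp add: bconst_def)
  have *: "degree (map_poly bconst f) = degree f"
    by (rule degree_map_poly) (auto simp: bconst_def)
  show ?thesis
    unfolding usubst_def poly_altdef * by (simp add: coeff_map_poly bscale_def)
qed

lemma bsubst_altdef:
  "bsubst f s t =
    (\<Sum>i\<le>degree f. \<Sum>j\<le>degree (coeff f i). bscale (coeff (coeff f i) j) (s ^ i * t ^ j))"
proof -
  have 0: "usubst 0 t = 0" by (simp add: usubst_def)
  have "bsubst f s t = (\<Sum>i\<le>degree f. coeff (map_poly (\<lambda>c. usubst c t) f) i * s ^ i)"
    unfolding bsubst_def poly_altdef
    using map_poly_degree_leq[of "\<lambda>c. usubst c t" f]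
    by (intro sum.mono_neutral_left) (auto simp: coeff_eq_0)
  also have "\<dots> = (\<Sum>i\<le>degree f. usubst (coeff f i) t * s ^ i)"
    by (simp add: coeff_map_poly 0)
  finally show ?thesis
    by (simp add: usubst_altdef bscale_def sum_distrib_right sum_distrib_left mult_ac)
qed

lemma ex_mem_Pi2: "\<exists>n. p \<in> Pi2 n"
proof -
  define n where "n = degree p + (\<Sum>i\<le>degree p. degree (coeff p i))"
  have "coeff (coeff p i) j = 0" if "i + j > n" for i j
  proof (cases "i \<le> degree p")
    case True
    then have "degree (coeff p i) \<le> (\<Sum>i\<le>degree p. degree (coeff p i))"
      by (intro member_le_sum) auto
    then show ?thesis using that True by (intro coeff_eq_0) (simp add: n_def)
  qed (simp add: coeff_eq_0)
  then show ?thesis unfolding Pi2_def by blast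
qed

lemma total_degree_le_iff: "total_degree p \<le> n \<longleftrightarrow> p \<in> Pi2 n"
proof
  have "p \<in> Pi2 (total_degree p)"
    unfolding total_degree_def using ex_mem_Pi2 by (rule LeastI_ex)
  then show "total_degree p \<le> n \<Longrightarrow> p \<in> Pi2 n" by (auto simp: Pi2_def)
qed (simp add: total_degree_def Least_le)

end

theory Submission
  imports Defs
begin

text \<open>
  Homogenize: a polynomial of degree at most two is a conic in the projective plane, it is
  factorizable iff the conic is a pair of lines, and then its discriminant vanishes. Two of the
  given factorizable members, \<open>r\<^sub>1 = l l'\<close> and \<open>r\<^sub>2 = m m'\<close>, span the pencil. With
  \<open>[u, v, w]\<close> for the determinant of three linear forms, the discriminant of
  \<open>\<kappa> r\<^sub>1 + \<mu> r\<^sub>2\<close> turns out to be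
  \<open>- \<kappa> \<mu> (\<kappa> [l, l', m] [l, l', m'] + \<mu> [m, m', l] [m, m', l'])\<close> (lemma \<open>conic_disc_pencil\<close>).
  The other two factorizable members have nonzero, non-proportional coordinates
  \<open>(\<kappa>, \<mu>)\<close>, so they give two independent linear equations and both products of brackets
  vanish (lemma \<open>brackets_eq_0\<close>).

  Hence, after possibly exchanging \<open>l\<close> with \<open>l'\<close> and \<open>m\<close> with \<open>m'\<close>, we have
  \<open>[l, l', m] = 0 = [m, m', l]\<close>: when the lines of each pair are distinct, \<open>m\<close> passes through
  the vertex of the first pair and \<open>l\<close> through the vertex of the second. If \<open>l\<close> and \<open>m\<close> are proportional, the whole pencil has
  this common factor, which is (a'). If they are independent, \<open>l'\<close> and \<open>m'\<close> are
  combinations of \<open>l\<close> and \<open>m\<close> (all four lines meet in one point), so the whole pencil consists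
  of binary quadratic forms in \<open>s = l\<close> and \<open>t = m\<close>, which is (c'); this includes (b'), where the
  common point is at infinity and one may take \<open>t = 1\<close>. In either case every member factors,
  in the second one because binary forms split over the complex numbers.
\<close>

text \<open>
  Here \<open>$\<close> is reserved for vector components; were it also the coefficient operator of
  power series, the number of readings of a formula would double with each occurrence.
\<close>
unbundle no Formal_Power_Series.fps_syntax

section \<open>Affine polynomials as linear forms in three variables\<close>

lemma bconst_hom: "bconst (a + b) = bconst a + bconst b" "bconst (a * b) = bconst a * bconst b"
  "bconst (- a) = - bconst a" "bconst 1 = 1" "bconst 0 = 0"
  by (simp_all add: bconst_def one_pCons)

lemma coeff_bscale: "coeff (coeff (bscale c p) i) j = c * coeff (coeff p i) j"
  by (simp add: bscale_def bconst_def)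

lemma Pi2_comb:
  assumes "p \<in> Pi2 n" "q \<in> Pi2 n"
  shows "bscale \<alpha> p + bscale \<beta> q \<in> Pi2 n"
  using assms by (simp add: Pi2_def coeff_bscale)

definition lin_form :: "complex ^ 3 \<Rightarrow> bipoly"
  where "lin_form u = bscale (u $ 1) var_x + bscale (u $ 2) var_y + bconst (u $ 3)"

lemma lin_form_pCons: "lin_form u = [:[:u $ 3, u $ 2:], [:u $ 1:]:]"
  by (simp add: lin_form_def bscale_def bconst_def var_x_def var_y_def)

lemma lin_form_add: "lin_form (u + v) = lin_form u + lin_form v"
  by (simp add: lin_form_pCons)

lemma lin_form_smult: "lin_form (c *s u) = bscale c (lin_form u)"
  by (simp add: lin_form_pCons bscale_def bconst_def)

lemma Pi2_1_eq_range_lin_form: "Pi2 1 = range lin_form"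
proof (intro equalityI subsetI)
  fix m assume "m \<in> Pi2 1"
  then have z: "coeff (coeff m i) j = 0" if "i + j > 1" for i j
    using that by (auto simp: Pi2_def)
  have "m = lin_form (vector [coeff (coeff m 1) 0, coeff (coeff m 0) 1, coeff (coeff m 0) 0])"
    by (intro poly_eqI) (auto simp: lin_form_pCons coeff_pCons z vector_3 split: nat.split)
  then show "m \<in> range lin_form" by blast
qed (auto simp: Pi2_def lin_form_pCons coeff_pCons split: nat.split)

lemma lin_form_mult:
  "lin_form u * lin_form v =
    [:[:u $ 3 * v $ 3, u $ 2 * v $ 3 + u $ 3 * v $ 2, u $ 2 * v $ 2:],
      [:u $ 1 * v $ 3 + u $ 3 * v $ 1, u $ 1 * v $ 2 + u $ 2 * v $ 1:],
      [:u $ 1 * v $ 1:]:]"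
  by (simp add: lin_form_pCons algebra_simps)

section \<open>The discriminant on a pencil spanned by two line pairs\<close>

definition bracket :: "complex ^ 3 \<Rightarrow> complex ^ 3 \<Rightarrow> complex ^ 3 \<Rightarrow> complex"
  where "bracket u v w = det (vector [u, v, w] :: complex ^ 3 ^ 3)"

lemma bracket_expand:
  "bracket u v w = u $ 1 * v $ 2 * w $ 3 + u $ 2 * v $ 3 * w $ 1 + u $ 3 * v $ 1 * w $ 2
    - u $ 1 * v $ 3 * w $ 2 - u $ 2 * v $ 1 * w $ 3 - u $ 3 * v $ 2 * w $ 1"
  by (simp add: bracket_def det_3 vector_3)

lemma bracket_swap: "bracket v u w = - bracket u v w"
  by (simp add: bracket_expand)

text \<open>
  Up to the factor 4 this is the determinant of the symmetric matrix of the homogenization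
  \<open>a x\<^sup>2 + b x y + c y\<^sup>2 + d x z + e y z + f z\<^sup>2\<close>.
\<close>
definition conic_disc :: "bipoly \<Rightarrow> complex" where
  "conic_disc r = (let a = coeff (coeff r 2) 0; b = coeff (coeff r 1) 1; c = coeff (coeff r 0) 2;
      d = coeff (coeff r 1) 0; e = coeff (coeff r 0) 1; f = coeff (coeff r 0) 0
    in 4 * a * c * f + b * d * e - a * e\<^sup>2 - c * d\<^sup>2 - f * b\<^sup>2)"

lemma conic_disc_lin_form_mult: "conic_disc (lin_form u * lin_form v) = 0"
  unfolding lin_form_mult conic_disc_def by (simp add: numeral_2_eq_2 Let_def) algebra

text \<open>
  The cubes of \<open>\<kappa>\<close> and \<open>\<mu>\<close> are absent because the two generators are themselves singular.
  The coefficient of \<open>\<kappa>\<^sup>2 \<mu>\<close> is, up to sign, the value of the second conic at the cross product of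
  \<open>u\<close> and \<open>u'\<close>, the vertex of the first pair; a bracket is the value of one linear factor there.
\<close>
lemma conic_disc_pencil:
  "conic_disc (bscale \<kappa> (lin_form u * lin_form u') + bscale \<mu> (lin_form w * lin_form w')) =
   - \<kappa> * \<mu> * (\<kappa> * (bracket u u' w * bracket u u' w') + \<mu> * (bracket w w' u * bracket w w' u'))"
  unfolding lin_form_mult conic_disc_def bracket_def det_3 vector_3 bscale_def bconst_def
  by (simp add: numeral_2_eq_2 Let_def) algebra

text \<open>
  At a singular member of the pencil other than the two generators, the factor \<open>\<kappa> \<mu>\<close> can
  be cancelled from the discriminant; two such members leave a regular linear system for the
  two products of brackets.
\<close>
lemma brackets_eq_0:
  assumes "factorizable (bscale \<kappa> (lin_form u * lin_form u') + bscale \<mu> (lin_form w * lin_form w'))"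
    and "factorizable (bscale \<kappa>' (lin_form u * lin_form u') + bscale \<mu>' (lin_form w * lin_form w'))"
    and "\<kappa> \<noteq> 0" "\<mu> \<noteq> 0" "\<kappa>' \<noteq> 0" "\<mu>' \<noteq> 0" "\<kappa> * \<mu>' - \<mu> * \<kappa>' \<noteq> 0"
  shows "bracket u u' w * bracket u u' w' = 0" "bracket w w' u * bracket w w' u' = 0"
proof -
  define A B where "A = bracket u u' w * bracket u u' w'" and "B = bracket w w' u * bracket w w' u'"
  have disc: "conic_disc r = 0" if "factorizable r" for r
    using that conic_disc_lin_form_mult unfolding factorizable_def Pi2_1_eq_range_lin_form by blast
  have 1: "\<kappa> * A + \<mu> * B = 0"
    using disc[OF assms(1)] assms(3,4) by (simp add: conic_disc_pencil A_def B_def)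
  have 2: "\<kappa>' * A + \<mu>' * B = 0"
    using disc[OF assms(2)] assms(5,6) by (simp add: conic_disc_pencil A_def B_def)
  have "(\<kappa> * \<mu>' - \<mu> * \<kappa>') * A = 0" "(\<kappa> * \<mu>' - \<mu> * \<kappa>') * B = 0"
    using 1 2 by algebra+
  with assms(7) show "bracket u u' w * bracket u u' w' = 0" "bracket w w' u * bracket w w' u' = 0"
    by (simp_all add: A_def B_def)
qed

section \<open>Changing the basis of a pencil\<close>

lemma noncollinear_det:
  assumes "noncollinear u v"
  shows "u $ 1 * v $ 2 - u $ 2 * v $ 1 \<noteq> 0"
proof
  assume d: "u $ 1 * v $ 2 - u $ 2 * v $ 1 = 0"
  have ind: "a = 0 \<and> b = 0" if "a *s u + b *s v = 0" for a b
    using assms that unfolding noncollinear_def lin_indep2_iff[OF vec.vector_space_axioms] by blast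
  have "v $ 2 = 0 \<and> - u $ 2 = 0" "v $ 1 = 0 \<and> - u $ 1 = 0"
    by (rule ind; use d in \<open>simp add: vec_eq_iff forall_2 algebra_simps\<close>)+
  then have "1 *s u + 0 *s v = 0" by (simp add: vec_eq_iff forall_2)
  from ind[OF this] show False by simp
qed

text \<open>
  Cramer's rule for the coordinates of a member of the pencil with respect to two members
  \<open>a p + b q\<close> and \<open>a' p + b' q\<close>.
\<close>
lemma change_of_basis:
  assumes "a * b' - b * a' \<noteq> 0"
  shows "bscale \<alpha> p + bscale \<beta> q =
    bscale ((\<alpha> * b' - \<beta> * a') / (a * b' - b * a')) (bscale a p + bscale b q) +
    bscale ((a * \<beta> - b * \<alpha>) / (a * b' - b * a')) (bscale a' p + bscale b' q)"
proof (intro poly_eqI)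
  fix i j
  define P Q where "P = coeff (coeff p i) j" and "Q = coeff (coeff q i) j"
  have "\<alpha> * P + \<beta> * Q =
    ((\<alpha> * b' - \<beta> * a') / (a * b' - b * a')) * (a * P + b * Q) +
    ((a * \<beta> - b * \<alpha>) / (a * b' - b * a')) * (a' * P + b' * Q)"
    using assms by (simp add: divide_simps) (simp add: algebra_simps)
  then show "coeff (coeff (bscale \<alpha> p + bscale \<beta> q) i) j =
    coeff (coeff (bscale ((\<alpha> * b' - \<beta> * a') / (a * b' - b * a')) (bscale a p + bscale b q) +
    bscale ((a * \<beta> - b * \<alpha>) / (a * b' - b * a')) (bscale a' p + bscale b' q)) i) j"
    by (simp add: coeff_bscale P_def Q_def)
qed

section \<open>Binary quadratic forms in two affine polynomials\<close>

definition quad_forms :: "bipoly \<Rightarrow> bipoly \<Rightarrow> bipoly set" where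
  "quad_forms s t = {bscale a (s * s) + bscale b (s * t) + bscale c (t * t) | a b c. True}"

lemma quad_formsI: "bscale a (s * s) + bscale b (s * t) + bscale c (t * t) \<in> quad_forms s t"
  by (auto simp: quad_forms_def)

lemma quad_forms_comb:
  assumes "p \<in> quad_forms s t" "q \<in> quad_forms s t"
  shows "bscale \<alpha> p + bscale \<beta> q \<in> quad_forms s t"
proof -
  from assms obtain a b c a' b' c' where
    "p = bscale a (s * s) + bscale b (s * t) + bscale c (t * t)"
    "q = bscale a' (s * s) + bscale b' (s * t) + bscale c' (t * t)"
    unfolding quad_forms_def by blast
  then have "bscale \<alpha> p + bscale \<beta> q = bscale (\<alpha> * a + \<beta> * a') (s * s)
      + bscale (\<alpha> * b + \<beta> * b') (s * t) + bscale (\<alpha> * c + \<beta> * c') (t * t)"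
    by (simp add: bscale_def bconst_hom algebra_simps)
  then show ?thesis by (metis quad_formsI)
qed

lemma quad_forms_bsubst:
  assumes "r \<in> quad_forms s t"
  shows "\<exists>f\<in>Pi2_hom 2. r = bsubst f s t"
proof -
  from assms obtain a b c where
    r: "r = bscale a (s * s) + bscale b (s * t) + bscale c (t * t)"
    unfolding quad_forms_def by blast
  define f :: bipoly where "f = [:[:0, 0, c:], [:0, b:], [:a:]:]"
  have "f \<in> Pi2_hom 2"
    by (auto simp: f_def Pi2_hom_def coeff_pCons split: nat.split)
  moreover have "r = bsubst f s t"
    by (simp add: r f_def bsubst_def usubst_def map_poly_pCons bconst_hom bscale_def algebra_simps)
  ultimately show ?thesis by blast
qed

text \<open>
  With roots \<open>x\<close>, \<open>y\<close> of \<open>a z\<^sup>2 + b z + c\<close>, the form is \<open>a (s - x t) (s - y t)\<close>; if \<open>a = 0\<close>,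
  it is divisible by \<open>t\<close>.
\<close>
lemma quad_forms_factor:
  assumes "r \<in> quad_forms (lin_form u) (lin_form w)"
  shows "\<exists>m1\<in>Pi2 1. \<exists>m2\<in>Pi2 1. r = m1 * m2"
proof -
  let ?s = "lin_form u" and ?t = "lin_form w"
  from assms obtain a b c where
    r: "r = bscale a (?s * ?s) + bscale b (?s * ?t) + bscale c (?t * ?t)"
    unfolding quad_forms_def by blast
  have "\<exists>v v'. r = lin_form v * lin_form v'"
  proof (cases "a = 0")
    case True
    then have "r = lin_form w * lin_form (b *s u + c *s w)"
      by (simp add: r lin_form_add lin_form_smult bscale_def bconst_hom algebra_simps)
    then show ?thesis by blast
  next
    case False
    define \<delta> where "\<delta> = csqrt (b\<^sup>2 - 4 * a * c)"
    define x y where "x = (- b + \<delta>) / (2 * a)" and "y = (- b - \<delta>) / (2 * a)"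
    have "\<delta>\<^sup>2 = b\<^sup>2 - 4 * a * c" by (simp add: \<delta>_def)
    moreover have "a * x * y = (b\<^sup>2 - \<delta>\<^sup>2) / (4 * a)"
      using False by (simp add: x_def y_def field_simps power2_eq_square)
    ultimately have "c = a * x * y"
      using False by simp
    moreover have "b = - (a * (x + y))"
      using False by (simp add: x_def y_def field_simps)
    ultimately have vieta: "b = - (a * (x + y))" "c = a * x * y" by blast+
    have "r = lin_form (a *s (u + (- x) *s w)) * lin_form (u + (- y) *s w)"
      unfolding r vieta
      by (simp only: lin_form_add lin_form_smult bscale_def bconst_hom) (simp add: algebra_simps)
    then show ?thesis by blast
  qed
  then show ?thesis unfolding Pi2_1_eq_range_lin_form by blast
qed

section \<open>Two line pairs with a common line or a common vertex\<close>

lemma bracket_eq_0_span: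
  assumes "bracket u v w = 0" and "\<And>a b. a *s u + b *s v = 0 \<Longrightarrow> a = 0 \<and> b = 0"
  obtains a b where "w = a *s u + b *s v"
proof -
  let ?A = "vector [u, v, w] :: complex ^ 3 ^ 3"
  have rows: "row 1 ?A = u" "row 2 ?A = v" "row 3 ?A = w"
    by (simp_all add: row_def vec_eq_iff vector_3)
  have "\<not> (\<exists>B. ?A ** B = mat 1)"
    using assms(1) unfolding bracket_def
    by (metis invertible_det_nz invertible_right_inverse)
  then obtain c where c: "(\<Sum>i\<in>UNIV. c i *s row i ?A) = 0" and "\<not> (\<forall>i. c i = 0)"
    unfolding matrix_right_invertible_independent_rows by blast
  from c have c: "c 1 *s u + c 2 *s v + c 3 *s w = 0"
    by (simp add: sum_3 rows)
  have "c 3 \<noteq> 0"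
  proof
    assume "c 3 = 0"
    with c assms(2) have "c 1 = 0 \<and> c 2 = 0" by simp
    with \<open>c 3 = 0\<close> \<open>\<not> (\<forall>i. c i = 0)\<close> show False by (simp add: forall_3)
  qed
  have "w = (- c 1 / c 3) *s u + (- c 2 / c 3) *s v"
    using c \<open>c 3 \<noteq> 0\<close>
    by (simp add: vec_eq_iff field_simps) (metis add.commute add_eq_0_iff)
  then show thesis by (rule that)
qed

text \<open>
  If the forms of \<open>u\<close> and \<open>w\<close> are independent, a vanishing bracket puts \<open>u'\<close> and \<open>w'\<close>
  into their span, so that the four lines are concurrent. Otherwise \<open>u\<close> and \<open>w\<close> describe the
  same line.
\<close>
lemma common_line_or_point:
  assumes "bracket u u' w = 0" "bracket w w' u = 0" "u \<noteq> 0" "w \<noteq> 0"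
  shows "(\<exists>c. lin_form w = bscale c (lin_form u)) \<or>
    lin_form u * lin_form u' \<in> quad_forms (lin_form u) (lin_form w) \<and>
    lin_form w * lin_form w' \<in> quad_forms (lin_form u) (lin_form w)"
proof (cases "\<exists>a b. a *s u + b *s w = 0 \<and> \<not> (a = 0 \<and> b = 0)")
  case True
  then obtain a b where ab: "a *s u + b *s w = 0" "\<not> (a = 0 \<and> b = 0)" by blast
  with \<open>u \<noteq> 0\<close> have "b \<noteq> 0" by auto
  have "w = (- a / b) *s u"
    using ab(1) \<open>b \<noteq> 0\<close> by (simp add: vec_eq_iff field_simps add_eq_0_iff)
  then show ?thesis using lin_form_smult by metis
next
  case False
  then have ind: "\<And>a b. a *s u + b *s w = 0 \<Longrightarrow> a = 0 \<and> b = 0" by blast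
  have "bracket u w u' = 0" "bracket u w w' = 0"
    using assms(1,2) by (simp_all add: bracket_expand algebra_simps)
  then obtain a b a' b' where "u' = a *s u + b *s w" "w' = a' *s u + b' *s w"
    using bracket_eq_0_span[OF _ ind] by metis
  then have "lin_form u * lin_form u' = bscale a (lin_form u * lin_form u) +
      bscale b (lin_form u * lin_form w) + bscale 0 (lin_form w * lin_form w)"
    "lin_form w * lin_form w' = bscale 0 (lin_form u * lin_form u) +
      bscale a' (lin_form u * lin_form w) + bscale b' (lin_form w * lin_form w)"
    by (simp_all add: lin_form_add lin_form_smult bscale_def bconst_hom algebra_simps)
  then show ?thesis by (metis quad_formsI)
qed

text \<open>
  Each vanishing product singles out one line of one pair whose form is linearly dependent on the
  forms of the other pair. Naming these lines \<open>w\<close> and \<open>u\<close> reduces all four cases to the previous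
  lemma.
\<close>
lemma common_line_or_point_products:
  assumes "bracket u u' w * bracket u u' w' = 0" "bracket w w' u * bracket w w' u' = 0"
    and "lin_form u * lin_form u' \<noteq> 0" "lin_form w * lin_form w' \<noteq> 0"
  shows "(\<exists>l\<in>Pi2 1. \<exists>l1\<in>Pi2 1. \<exists>l2\<in>Pi2 1.
      lin_form u * lin_form u' = l * l1 \<and> lin_form w * lin_form w' = l * l2) \<or>
    (\<exists>s t. lin_form u * lin_form u' \<in> quad_forms (lin_form s) (lin_form t) \<and>
      lin_form w * lin_form w' \<in> quad_forms (lin_form s) (lin_form t))"
    (is "?line (lin_form u * lin_form u') (lin_form w * lin_form w') \<or>
      ?point (lin_form u * lin_form u') (lin_form w * lin_form w')")
proof -
  have nz: "x \<noteq> 0" if "lin_form x \<noteq> 0" for x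
    using that by (auto simp: lin_form_pCons)
  have *: "?line (lin_form x * lin_form x') (lin_form y * lin_form y') \<or>
      ?point (lin_form x * lin_form x') (lin_form y * lin_form y')"
    if "bracket x x' y = 0" "bracket y y' x = 0" "x \<noteq> 0" "y \<noteq> 0" for x x' y y'
    using common_line_or_point[OF that]
  proof (elim disjE exE)
    fix c assume "lin_form y = bscale c (lin_form x)"
    then have "lin_form y * lin_form y' = lin_form x * lin_form (c *s y')"
      by (simp add: lin_form_smult bscale_def)
    then show ?thesis unfolding Pi2_1_eq_range_lin_form by blast
  qed blast
  have "bracket u u' x = 0 \<longleftrightarrow> bracket u' u x = 0" "bracket w w' x = 0 \<longleftrightarrow> bracket w' w x = 0" for x
    using bracket_swap by (metis neg_equal_0_iff_equal)+
  then consider "bracket u u' w = 0" "bracket w w' u = 0" | "bracket u' u w = 0" "bracket w w' u' = 0"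
    | "bracket u u' w' = 0" "bracket w' w u = 0" | "bracket u' u w' = 0" "bracket w' w u' = 0"
    using assms(1,2) by auto
  then show ?thesis
  proof cases
    case 1 then show ?thesis using *[of u u' w w'] assms(3,4) nz by force
  next
    case 2 then show ?thesis using *[of u' u w w'] assms(3,4) nz by (force simp: mult.commute)
  next
    case 3 then show ?thesis using *[of u u' w' w] assms(3,4) nz by (force simp: mult.commute)
  next
    case 4 then show ?thesis using *[of u' u w' w] assms(3,4) nz by (force simp: mult.commute)
  qed
qed

text \<open>
  A common linear form could be the line at infinity, which dehomogenizes to a constant. A
  member of degree two excludes this.
\<close>
lemma common_factor_degree_1:
  assumes "l \<in> Pi2 1" "l1 \<in> Pi2 1" "total_degree (l * l1) = 2"
  shows "total_degree l = 1"
proof (rule antisym)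
  show "total_degree l \<le> 1" using assms(1) by (simp only: total_degree_le_iff)
  show "1 \<le> total_degree l"
  proof (rule ccontr)
    assume "\<not> 1 \<le> total_degree l"
    then have l0: "l \<in> Pi2 0" by (simp add: total_degree_le_iff[symmetric])
    from assms(1) obtain u where u: "l = lin_form u" unfolding Pi2_1_eq_range_lin_form by blast
    have "coeff (coeff l 1) 0 = 0" "coeff (coeff l 0) 1 = 0" using l0 by (simp_all add: Pi2_def)
    then have "l = bconst (u $ 3)" by (simp add: u lin_form_pCons bconst_def)
    then have "l * l1 = bscale (u $ 3) l1 + bscale 0 l1" by (simp add: bscale_def bconst_hom)
    then have "l * l1 \<in> Pi2 1" using Pi2_comb[OF assms(2,2)] by simp
    then show False using assms(3) total_degree_le_iff[of "l * l1" 1] by simp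
  qed
qed

section \<open>Pencils with four factorizable members\<close>

theorem theorem3p1:
  fixes p q :: bipoly and v :: "nat \<Rightarrow> complex ^ 2"
  assumes "total_degree p = 2" and "total_degree q = 2"
    and "lin_indep2 bscale p q"
    and "\<forall>i\<in>{1..4}. \<forall>j\<in>{1..4}. i \<noteq> j \<longrightarrow> noncollinear (v i) (v j)"
    and "\<forall>i\<in>{1..4}. factorizable (bscale (v i $ 1) p + bscale (v i $ 2) q)"
  shows "((\<exists>l l1 l2. l \<in> Pi2 1 \<and> l1 \<in> Pi2 1 \<and> l2 \<in> Pi2 1 \<and> total_degree l = 1 \<and>
            p = l * l1 \<and> q = l * l2)
        \<or> (\<exists>f g :: complex poly. \<exists>a1 b1 :: complex. \<exists>s.
            degree f = 2 \<and> degree g = 2 \<and> a1\<^sup>2 + b1\<^sup>2 \<noteq> 0 \<and>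
            s = bscale a1 var_x + bscale b1 var_y \<and>
            p = usubst f s \<and> q = usubst g s)
        \<or> (\<exists>f\<in>Pi2_hom 2. \<exists>g\<in>Pi2_hom 2. \<exists>a1 b1 c1 a2 b2 c2 :: complex. \<exists>s t.
            s = bscale a1 var_x + bscale b1 var_y + bconst c1 \<and>
            t = bscale a2 var_x + bscale b2 var_y + bconst c2 \<and>
            p = bsubst f s t \<and> q = bsubst g s t))
      \<and> (\<forall>\<alpha> \<beta> :: complex. factorizable (bscale \<alpha> p + bscale \<beta> q))"
    (is "(?common \<or> ?univariate \<or> ?binary) \<and> ?pencil")
proof -
  define r where "r i = bscale (v i $ 1) p + bscale (v i $ 2) q" for i
  define \<Delta> where "\<Delta> i j = v i $ 1 * v j $ 2 - v i $ 2 * v j $ 1" for i j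
  have \<Delta>: "\<Delta> i j \<noteq> 0" if "i \<in> {1..4}" "j \<in> {1..4}" "i \<noteq> j" for i j
    using assms(4) that noncollinear_det unfolding \<Delta>_def by blast
  have \<Delta>12: "\<Delta> 1 2 \<noteq> 0" by (rule \<Delta>) auto
  have fact: "factorizable (r i)" if "i \<in> {1..4}" for i
    using assms(5) that by (simp add: r_def)
  have nz: "r i \<noteq> 0" if "i \<in> {1..4}" for i
  proof
    assume "r i = 0"
    then have "v i $ 1 = 0 \<and> v i $ 2 = 0"
      using assms(3) unfolding r_def lin_indep2_iff[OF vector_space_bscale] by blast
    moreover obtain j where "j \<in> {1..4}" "i \<noteq> j"
      by (metis atLeastAtMost_iff one_le_numeral order_refl numeral_eq_one_iff semiring_norm(85))
    ultimately show False using \<Delta>[OF that] by (auto simp: \<Delta>_def)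
  qed
  have basis: "bscale \<alpha> p + bscale \<beta> q =
      bscale ((\<alpha> * v 2 $ 2 - \<beta> * v 2 $ 1) / \<Delta> 1 2) (r 1) +
      bscale ((v 1 $ 1 * \<beta> - v 1 $ 2 * \<alpha>) / \<Delta> 1 2) (r 2)" for \<alpha> \<beta>
    unfolding r_def \<Delta>_def by (rule change_of_basis) (use \<Delta>12 in \<open>simp add: \<Delta>_def\<close>)
  \<comment> \<open>The indices 1 and 2 carry the basis; pairwise independence of the four vectors makes the
    coordinates of the other two members nonzero and not proportional.\<close>
  have r_basis: "r i = bscale (\<Delta> i 2 / \<Delta> 1 2) (r 1) + bscale (\<Delta> 1 i / \<Delta> 1 2) (r 2)" for i
    using basis[of "v i $ 1" "v i $ 2"] by (simp add: r_def \<Delta>_def)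
  have "\<exists>u u'. r i = lin_form u * lin_form u'" if "i \<in> {1..4}" for i
    using fact[OF that] unfolding factorizable_def Pi2_1_eq_range_lin_form by blast
  then obtain u u' w w' where uw: "r 1 = lin_form u * lin_form u'" "r 2 = lin_form w * lin_form w'"
    by (metis atLeastAtMost_iff one_le_numeral order_refl numeral_le_iff semiring_norm(68,69,71))
  have fact_basis: "factorizable (bscale (\<Delta> i 2 / \<Delta> 1 2) (lin_form u * lin_form u') +
      bscale (\<Delta> 1 i / \<Delta> 1 2) (lin_form w * lin_form w'))" if "i \<in> {1..4}" for i
    using fact[OF that] r_basis[of i] uw by simp
  \<comment> \<open>The determinant of the coordinates of members 3 and 4, by the Pluecker relation for four
    vectors in the plane.\<close>
  have "\<Delta> 3 2 / \<Delta> 1 2 * (\<Delta> 1 4 / \<Delta> 1 2) - \<Delta> 1 3 / \<Delta> 1 2 * (\<Delta> 4 2 / \<Delta> 1 2) = \<Delta> 3 4 / \<Delta> 1 2"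
  proof -
    have "\<Delta> 3 2 * \<Delta> 1 4 - \<Delta> 1 3 * \<Delta> 4 2 = \<Delta> 3 4 * \<Delta> 1 2"
      by (simp add: \<Delta>_def algebra_simps)
    then show ?thesis using \<Delta>12 by (simp add: field_simps)
  qed
  then have brackets: "bracket u u' w * bracket u u' w' = 0" "bracket w w' u * bracket w w' u' = 0"
    using brackets_eq_0[OF fact_basis[of 3] fact_basis[of 4]] \<Delta> by auto
  have pq: "p = bscale 1 p + bscale 0 q" "q = bscale 0 p + bscale 1 q"
    by (simp_all add: bscale_def bconst_hom)
  have Pi2: "bscale \<alpha> p + bscale \<beta> q \<in> Pi2 2" for \<alpha> \<beta>
    using assms(1,2) by (intro Pi2_comb) (simp_all add: total_degree_le_iff[symmetric])
  have "lin_form u * lin_form u' \<noteq> 0" "lin_form w * lin_form w' \<noteq> 0"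
    using nz[of 1] nz[of 2] uw by auto
  from common_line_or_point_products[OF brackets this] show ?thesis
  proof (elim disjE bexE exE conjE)
    fix l l1 l2
    assume l: "l \<in> Pi2 1" "l1 \<in> Pi2 1" "l2 \<in> Pi2 1"
      "lin_form u * lin_form u' = l * l1" "lin_form w * lin_form w' = l * l2"
    have comb: "\<exists>m\<in>Pi2 1. bscale \<alpha> p + bscale \<beta> q = l * m" for \<alpha> \<beta>
    proof -
      let ?a = "(\<alpha> * v 2 $ 2 - \<beta> * v 2 $ 1) / \<Delta> 1 2"
      let ?b = "(v 1 $ 1 * \<beta> - v 1 $ 2 * \<alpha>) / \<Delta> 1 2"
      have "bscale \<alpha> p + bscale \<beta> q = l * (bscale ?a l1 + bscale ?b l2)"
        unfolding basis[of \<alpha> \<beta>] uw l(4,5) by (simp add: bscale_def algebra_simps)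
      then show ?thesis using Pi2_comb[OF l(2,3)] by blast
    qed
    from comb[of 1 0] comb[of 0 1] obtain m1 m2 where
      m: "m1 \<in> Pi2 1" "m2 \<in> Pi2 1" "p = l * m1" "q = l * m2"
      unfolding pq[symmetric] by blast
    moreover have "total_degree l = 1"
      using common_factor_degree_1[OF l(1) m(1)] assms(1) m(3) by simp
    ultimately have ?common using l(1) by blast
    moreover have ?pencil
      using comb l(1) Pi2 unfolding factorizable_def by blast
    ultimately show ?thesis by blast
  next
    fix s t
    assume st: "lin_form u * lin_form u' \<in> quad_forms (lin_form s) (lin_form t)"
      "lin_form w * lin_form w' \<in> quad_forms (lin_form s) (lin_form t)"
    have comb: "bscale \<alpha> p + bscale \<beta> q \<in> quad_forms (lin_form s) (lin_form t)" for \<alpha> \<beta>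
      unfolding basis[of \<alpha> \<beta>] uw by (rule quad_forms_comb[OF st])
    have "p \<in> quad_forms (lin_form s) (lin_form t)" "q \<in> quad_forms (lin_form s) (lin_form t)"
      using comb[of 1 0] comb[of 0 1] by (simp_all only: pq[symmetric])
    then obtain f g where "f \<in> Pi2_hom 2" "g \<in> Pi2_hom 2"
      "p = bsubst f (lin_form s) (lin_form t)" "q = bsubst g (lin_form s) (lin_form t)"
      using quad_forms_bsubst by metis
    then have ?binary unfolding lin_form_def by blast
    moreover have ?pencil
      using quad_forms_factor[OF comb] Pi2 unfolding factorizable_def by blast
    ultimately show ?thesis by blast
  qed
qed

end
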